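(* Let $(\Gamma,+)$ be an abelian group. Let $(M_i,d_i)$, $d_i:M_i\to\Gamma$, $i=1,2$, be two centrally $\Gamma$-graded sets. Let $M$ be the quotient of $M_1\times M_2$ by the equivalence relation defined by $(x.m_1,m_2)\sim(m_1,x.m_2)$ for all $x\in\Gamma$, $m_1\in M_1$, $m_2\in M_2$, and write $[m_1,m_2]$ for the class of $(m_1,m_2)$. Then $M$, together with the grading map and $\Gamma$-action $$d([m_1,m_2])=d_1(m_1)+d_2(m_2),\qquad x.[m_1,m_2]=[x.m_1,m_2]=[m_1,x.m_2],$$ is (well defined and) again a centrally $\Gamma$-graded set, denoted $M=M_1\times_z M_2$. The usual set-theoretic identification $(M_1\times M_2)\times M_3=M_1\times(M_2\times M_3)$ induces a natural isomorphism of centrally $\Gamma$-graded sets $$(M_1\times_z M_2)\times_z M_3\cong M_1\times_z(M_2\times_z M_3).$$ The set $E=\Gamma$ with $d(m)=0$ and $x.m=x+m$ is a unit: $E\times_z M\cong M\cong M\times_z E$ for every centrally $\Gamma$-graded set $M$. In summary, centrally $\Gamma$-graded sets together with $\times_z$ form a monoidal category.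
   Context: Let $(\Gamma,+)$ be an abelian group. A $\Gamma$-graded set is a set $M$ with a map $d:M\to\Gamma$ (the grading, or degree, map). It is called centrally $\Gamma$-graded if it is equipped with a left action $z:\Gamma\times M\to M$, $(x,m)\mapsto x.m$, of the group $(\Gamma,+)$ preserving the grading: $d(x.m)=d(m)$ for all $x\in\Gamma$, $m\in M$. A morphism of centrally $\Gamma$-graded sets is a map $f:M\to M'$ with $d'(f(m))=d(m)$ and $f(x.m)=x.f(m)$ for all $m\in M$, $x\in\Gamma$. On morphisms, $\times_z$ is given by $(f_1\times_z f_2)[x_1,x_2]=[f_1(x_1),f_2(x_2)]$. *)

theory Defs
  imports Main "HOL-Library.FuncSet"
begin

section \<open>Centrally graded sets\<close>

text \<open>The group is the whole type \<open>'g\<close>. The functions \<open>deg\<close> and \<open>act\<close> only matter on the carrier;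
  they are required to be extensional, so that equality of records is equality of
  centrally graded sets.\<close>

record ('g, 'a) cgset =
  carrier :: "'a set"
  deg :: "'a \<Rightarrow> 'g"
  act :: "'g \<Rightarrow> 'a \<Rightarrow> 'a"

definition centrally_graded :: "('g::ab_group_add, 'a) cgset \<Rightarrow> bool" where
  "centrally_graded M \<longleftrightarrow>
     deg M \<in> extensional (carrier M) \<and>
     (\<forall>x. act M x \<in> carrier M \<rightarrow>\<^sub>E carrier M) \<and>
     (\<forall>m\<in>carrier M. act M 0 m = m) \<and>
     (\<forall>x y. \<forall>m\<in>carrier M. act M (x + y) m = act M x (act M y m)) \<and>
     (\<forall>x. \<forall>m\<in>carrier M. deg M (act M x m) = deg M m)"

definition cg_hom :: "('g, 'a) cgset \<Rightarrow> ('g, 'b) cgset \<Rightarrow> ('a \<Rightarrow> 'b) set" where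
  "cg_hom M N = {f \<in> carrier M \<rightarrow>\<^sub>E carrier N.
     \<forall>m\<in>carrier M. deg N (f m) = deg M m \<and> (\<forall>x. f (act M x m) = act N x (f m))}"

definition cg_id :: "('g, 'a) cgset \<Rightarrow> 'a \<Rightarrow> 'a" where
  "cg_id M = (\<lambda>m\<in>carrier M. m)"

definition cg_iso :: "('g, 'a) cgset \<Rightarrow> ('g, 'b) cgset \<Rightarrow> ('a \<Rightarrow> 'b) \<Rightarrow> bool" where
  "cg_iso M N f \<longleftrightarrow> f \<in> cg_hom M N \<and>
     (\<exists>g\<in>cg_hom N M. compose (carrier M) g f = cg_id M \<and> compose (carrier N) f g = cg_id N)"

section \<open>The product\<close>

definition zrel :: "('g, 'a) cgset \<Rightarrow> ('g, 'b) cgset \<Rightarrow> (('a \<times> 'b) \<times> ('a \<times> 'b)) set" where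
  "zrel M N = {((act M x m, n), (m, act N x n)) | x m n. m \<in> carrier M \<and> n \<in> carrier N}"

definition zclass :: "('g, 'a) cgset \<Rightarrow> ('g, 'b) cgset \<Rightarrow> 'a \<Rightarrow> 'b \<Rightarrow> ('a \<times> 'b) set" where
  "zclass M N m n = zrel M N `` {(m, n)}"

text \<open>A map on classes given by a formula in representatives is encoded with \<^const>\<open>the_elem\<close>
  applied to the set of all values at representatives.\<close>

definition zprod ::
  "('g::ab_group_add, 'a) cgset \<Rightarrow> ('g, 'b) cgset \<Rightarrow> ('g, ('a \<times> 'b) set) cgset"
  (infixl "\<times>\<^sub>z" 70) where
  "M \<times>\<^sub>z N =
    \<lparr>carrier = (carrier M \<times> carrier N) // zrel M N,
     deg = (\<lambda>X\<in>(carrier M \<times> carrier N) // zrel M N.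
              the_elem ((\<lambda>(m, n). deg M m + deg N n) ` X)),
     act = (\<lambda>x. \<lambda>X\<in>(carrier M \<times> carrier N) // zrel M N.
              the_elem ((\<lambda>(m, n). zclass M N (act M x m) n) ` X))\<rparr>"

definition zmap ::
  "('g::ab_group_add, 'a) cgset \<Rightarrow> ('g, 'b) cgset \<Rightarrow> ('g, 'c) cgset \<Rightarrow> ('g, 'd) cgset \<Rightarrow>
   ('a \<Rightarrow> 'c) \<Rightarrow> ('b \<Rightarrow> 'd) \<Rightarrow> ('a \<times> 'b) set \<Rightarrow> ('c \<times> 'd) set" where
  "zmap M1 M2 N1 N2 f1 f2 =
     (\<lambda>X\<in>carrier (M1 \<times>\<^sub>z M2). the_elem ((\<lambda>(m1, m2). zclass N1 N2 (f1 m1) (f2 m2)) ` X))"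

definition zassoc ::
  "('g::ab_group_add, 'a) cgset \<Rightarrow> ('g, 'b) cgset \<Rightarrow> ('g, 'c) cgset \<Rightarrow>
   (('a \<times> 'b) set \<times> 'c) set \<Rightarrow> ('a \<times> ('b \<times> 'c) set) set" where
  "zassoc M1 M2 M3 =
     (\<lambda>X\<in>carrier ((M1 \<times>\<^sub>z M2) \<times>\<^sub>z M3).
        the_elem {zclass M1 (M2 \<times>\<^sub>z M3) m1 (zclass M2 M3 m2 m3) | m1 m2 m3.
          m1 \<in> carrier M1 \<and> m2 \<in> carrier M2 \<and> m3 \<in> carrier M3 \<and>
          X = zclass (M1 \<times>\<^sub>z M2) M3 (zclass M1 M2 m1 m2) m3})"

definition zunit :: "('g::ab_group_add, 'g) cgset" where
  "zunit = \<lparr>carrier = UNIV, deg = (\<lambda>m. 0), act = (\<lambda>x m. x + m)\<rparr>"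

definition zlunit :: "('g::ab_group_add, 'a) cgset \<Rightarrow> ('g \<times> 'a) set \<Rightarrow> 'a" where
  "zlunit M = (\<lambda>X\<in>carrier (zunit \<times>\<^sub>z M). the_elem ((\<lambda>(x, m). act M x m) ` X))"

definition zrunit :: "('g::ab_group_add, 'a) cgset \<Rightarrow> ('a \<times> 'g) set \<Rightarrow> 'a" where
  "zrunit M = (\<lambda>X\<in>carrier (M \<times>\<^sub>z zunit). the_elem ((\<lambda>(m, x). act M x m) ` X))"

section \<open>Monoidal categories\<close>

text \<open>Hom-sets need not be disjoint; therefore composition and the tensor product of morphisms
  carry the objects involved as parameters: \<open>Comp A B C g f\<close> is the composite of
  \<open>f \<in> Hom A B\<close> and \<open>g \<in> Hom B C\<close>, and \<open>TenM A B A' B' f g \<in> Hom (Ten A B) (Ten A' B')\<close>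
  for \<open>f \<in> Hom A A'\<close> and \<open>g \<in> Hom B B'\<close>.\<close>

locale category =
  fixes Obj :: "'o set"
    and Hom :: "'o \<Rightarrow> 'o \<Rightarrow> 'm set"
    and Id :: "'o \<Rightarrow> 'm"
    and Comp :: "'o \<Rightarrow> 'o \<Rightarrow> 'o \<Rightarrow> 'm \<Rightarrow> 'm \<Rightarrow> 'm"
  assumes Id_in_Hom: "A \<in> Obj \<Longrightarrow> Id A \<in> Hom A A"
    and Comp_in_Hom: "\<lbrakk>A \<in> Obj; B \<in> Obj; C \<in> Obj; f \<in> Hom A B; g \<in> Hom B C\<rbrakk>
      \<Longrightarrow> Comp A B C g f \<in> Hom A C"
    and Comp_Id_right: "\<lbrakk>A \<in> Obj; B \<in> Obj; f \<in> Hom A B\<rbrakk> \<Longrightarrow> Comp A A B f (Id A) = f"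
    and Comp_Id_left: "\<lbrakk>A \<in> Obj; B \<in> Obj; f \<in> Hom A B\<rbrakk> \<Longrightarrow> Comp A B B (Id B) f = f"
    and Comp_assoc: "\<lbrakk>A \<in> Obj; B \<in> Obj; C \<in> Obj; D \<in> Obj;
        f \<in> Hom A B; g \<in> Hom B C; h \<in> Hom C D\<rbrakk>
      \<Longrightarrow> Comp A C D h (Comp A B C g f) = Comp A B D (Comp B C D h g) f"
begin

definition iso_in :: "'o \<Rightarrow> 'o \<Rightarrow> 'm \<Rightarrow> bool" where
  "iso_in A B f \<longleftrightarrow> f \<in> Hom A B \<and>
     (\<exists>g\<in>Hom B A. Comp A B A g f = Id A \<and> Comp B A B f g = Id B)"

end

locale monoidal_category = category Obj Hom Id Comp
  for Obj :: "'o set"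
    and Hom :: "'o \<Rightarrow> 'o \<Rightarrow> 'm set"
    and Id :: "'o \<Rightarrow> 'm"
    and Comp :: "'o \<Rightarrow> 'o \<Rightarrow> 'o \<Rightarrow> 'm \<Rightarrow> 'm \<Rightarrow> 'm" +
  fixes Ten :: "'o \<Rightarrow> 'o \<Rightarrow> 'o"
    and TenM :: "'o \<Rightarrow> 'o \<Rightarrow> 'o \<Rightarrow> 'o \<Rightarrow> 'm \<Rightarrow> 'm \<Rightarrow> 'm"
    and Unit :: "'o"
    and Assoc :: "'o \<Rightarrow> 'o \<Rightarrow> 'o \<Rightarrow> 'm"
    and LUnit :: "'o \<Rightarrow> 'm"
    and RUnit :: "'o \<Rightarrow> 'm"
  assumes Ten_in_Obj: "\<lbrakk>A \<in> Obj; B \<in> Obj\<rbrakk> \<Longrightarrow> Ten A B \<in> Obj"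
    and TenM_in_Hom: "\<lbrakk>A \<in> Obj; B \<in> Obj; A' \<in> Obj; B' \<in> Obj; f \<in> Hom A A'; g \<in> Hom B B'\<rbrakk>
      \<Longrightarrow> TenM A B A' B' f g \<in> Hom (Ten A B) (Ten A' B')"
    and TenM_Id: "\<lbrakk>A \<in> Obj; B \<in> Obj\<rbrakk> \<Longrightarrow> TenM A B A B (Id A) (Id B) = Id (Ten A B)"
    and TenM_Comp: "\<lbrakk>A \<in> Obj; B \<in> Obj; A' \<in> Obj; B' \<in> Obj; A'' \<in> Obj; B'' \<in> Obj;
        f \<in> Hom A A'; g \<in> Hom B B'; f' \<in> Hom A' A''; g' \<in> Hom B' B''\<rbrakk>
      \<Longrightarrow> TenM A B A'' B'' (Comp A A' A'' f' f) (Comp B B' B'' g' g) =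
          Comp (Ten A B) (Ten A' B') (Ten A'' B'')
            (TenM A' B' A'' B'' f' g') (TenM A B A' B' f g)"
    and Unit_in_Obj: "Unit \<in> Obj"
    and Assoc_iso: "\<lbrakk>A \<in> Obj; B \<in> Obj; C \<in> Obj\<rbrakk>
      \<Longrightarrow> iso_in (Ten (Ten A B) C) (Ten A (Ten B C)) (Assoc A B C)"
    and Assoc_natural: "\<lbrakk>A \<in> Obj; B \<in> Obj; C \<in> Obj; A' \<in> Obj; B' \<in> Obj; C' \<in> Obj;
        f \<in> Hom A A'; g \<in> Hom B B'; h \<in> Hom C C'\<rbrakk>
      \<Longrightarrow> Comp (Ten (Ten A B) C) (Ten (Ten A' B') C') (Ten A' (Ten B' C'))
            (Assoc A' B' C') (TenM (Ten A B) C (Ten A' B') C' (TenM A B A' B' f g) h) =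
          Comp (Ten (Ten A B) C) (Ten A (Ten B C)) (Ten A' (Ten B' C'))
            (TenM A (Ten B C) A' (Ten B' C') f (TenM B C B' C' g h)) (Assoc A B C)"
    and LUnit_iso: "A \<in> Obj \<Longrightarrow> iso_in (Ten Unit A) A (LUnit A)"
    and LUnit_natural: "\<lbrakk>A \<in> Obj; A' \<in> Obj; f \<in> Hom A A'\<rbrakk>
      \<Longrightarrow> Comp (Ten Unit A) (Ten Unit A') A' (LUnit A') (TenM Unit A Unit A' (Id Unit) f) =
          Comp (Ten Unit A) A A' f (LUnit A)"
    and RUnit_iso: "A \<in> Obj \<Longrightarrow> iso_in (Ten A Unit) A (RUnit A)"
    and RUnit_natural: "\<lbrakk>A \<in> Obj; A' \<in> Obj; f \<in> Hom A A'\<rbrakk>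
      \<Longrightarrow> Comp (Ten A Unit) (Ten A' Unit) A' (RUnit A') (TenM A Unit A' Unit f (Id Unit)) =
          Comp (Ten A Unit) A A' f (RUnit A)"
    and pentagon: "\<lbrakk>A \<in> Obj; B \<in> Obj; C \<in> Obj; D \<in> Obj\<rbrakk>
      \<Longrightarrow> Comp (Ten (Ten (Ten A B) C) D) (Ten (Ten A B) (Ten C D)) (Ten A (Ten B (Ten C D)))
            (Assoc A B (Ten C D)) (Assoc (Ten A B) C D) =
          Comp (Ten (Ten (Ten A B) C) D) (Ten A (Ten (Ten B C) D)) (Ten A (Ten B (Ten C D)))
            (TenM A (Ten (Ten B C) D) A (Ten B (Ten C D)) (Id A) (Assoc B C D))
            (Comp (Ten (Ten (Ten A B) C) D) (Ten (Ten A (Ten B C)) D) (Ten A (Ten (Ten B C) D))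
              (Assoc A (Ten B C) D)
              (TenM (Ten (Ten A B) C) D (Ten A (Ten B C)) D (Assoc A B C) (Id D)))"
    and triangle: "\<lbrakk>A \<in> Obj; B \<in> Obj\<rbrakk>
      \<Longrightarrow> Comp (Ten (Ten A Unit) B) (Ten A (Ten Unit B)) (Ten A B)
            (TenM A (Ten Unit B) A B (Id A) (LUnit B)) (Assoc A Unit B) =
          TenM (Ten A Unit) B A B (RUnit A) (Id B)"

section \<open>Centrally graded sets in a fixed universe type\<close>

text \<open>The carrier type of \<open>M \<times>\<^sub>z N\<close> differs from those of \<open>M\<close> and \<open>N\<close>, whereas the objects of one
  category must share a type. So the category is formed from the centrally graded sets whose carrier
  is a subset of a type \<open>'u\<close>, for an arbitrary \<open>'u\<close> that comes with injections
  \<open>p :: 'u \<times> 'u \<Rightarrow> 'u\<close> and \<open>e :: 'g \<Rightarrow> 'u\<close>. The product \<open>M \<times>\<^sub>z N\<close> and the unit are replaced by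
  isomorphic copies with carrier in \<open>'u\<close> (a class is coded by the code of a chosen representative),
  and all structure maps are transported along these isomorphisms.\<close>

lemma universe_exists:
  "\<exists>(p :: ('g + 'a + nat) \<times> ('g + 'a + nat) \<Rightarrow> 'g + 'a + nat) (e :: 'g \<Rightarrow> 'g + 'a + nat).
     inj p \<and> inj e"
proof -
  have "inj (\<lambda>n::nat. Inr (Inr n) :: 'g + 'a + nat)"
    by (auto simp: inj_on_def)
  then have "infinite (UNIV :: ('g + 'a + nat) set)"
    using finite_imageD finite_subset infinite_UNIV_nat subset_UNIV by metis
  then have "(card_of ((UNIV :: ('g + 'a + nat) set) \<times> (UNIV :: ('g + 'a + nat) set)),
      card_of (UNIV :: ('g + 'a + nat) set)) \<in> ordLeq"
    using card_of_Times_same_infinite ordIso_iff_ordLeq by blast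
  then obtain p :: "('g + 'a + nat) \<times> ('g + 'a + nat) \<Rightarrow> 'g + 'a + nat" where "inj p"
    unfolding card_of_ordLeq [symmetric] by auto
  moreover have "inj (Inl :: 'g \<Rightarrow> 'g + 'a + nat)" by simp
  ultimately show ?thesis by blast
qed

definition transport :: "('a \<Rightarrow> 'b) \<Rightarrow> ('g, 'a) cgset \<Rightarrow> ('g, 'b) cgset" where
  "transport j M =
    \<lparr>carrier = j ` carrier M,
     deg = (\<lambda>u\<in>j ` carrier M. deg M (inv_into (carrier M) j u)),
     act = (\<lambda>x. \<lambda>u\<in>j ` carrier M. j (act M x (inv_into (carrier M) j u)))\<rparr>"

definition code :: "('u \<times> 'u \<Rightarrow> 'u) \<Rightarrow> ('u \<times> 'u) set \<Rightarrow> 'u" where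
  "code p X = p (SOME q. q \<in> X)"

definition u_prod ::
  "('u \<times> 'u \<Rightarrow> 'u) \<Rightarrow> ('g::ab_group_add, 'u) cgset \<Rightarrow> ('g, 'u) cgset \<Rightarrow> ('g, 'u) cgset" where
  "u_prod p M N = transport (code p) (M \<times>\<^sub>z N)"

definition u_unit :: "('g::ab_group_add \<Rightarrow> 'u) \<Rightarrow> ('g, 'u) cgset" where
  "u_unit e = transport e zunit"

definition into ::
  "('u \<times> 'u \<Rightarrow> 'u) \<Rightarrow> ('g::ab_group_add, 'u) cgset \<Rightarrow> ('g, 'u) cgset \<Rightarrow> ('u \<times> 'u) set \<Rightarrow> 'u" where
  "into p M N = (\<lambda>X\<in>carrier (M \<times>\<^sub>z N). code p X)"

definition out ::
  "('u \<times> 'u \<Rightarrow> 'u) \<Rightarrow> ('g::ab_group_add, 'u) cgset \<Rightarrow> ('g, 'u) cgset \<Rightarrow> 'u \<Rightarrow> ('u \<times> 'u) set" where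
  "out p M N = (\<lambda>u\<in>carrier (u_prod p M N). inv_into (carrier (M \<times>\<^sub>z N)) (code p) u)"

definition out_unit :: "('g::ab_group_add \<Rightarrow> 'u) \<Rightarrow> 'u \<Rightarrow> 'g" where
  "out_unit e = (\<lambda>u\<in>carrier (u_unit e). inv_into UNIV e u)"

definition u_map ::
  "('u \<times> 'u \<Rightarrow> 'u) \<Rightarrow> ('g::ab_group_add, 'u) cgset \<Rightarrow> ('g, 'u) cgset \<Rightarrow>
   ('g, 'u) cgset \<Rightarrow> ('g, 'u) cgset \<Rightarrow> ('u \<Rightarrow> 'u) \<Rightarrow> ('u \<Rightarrow> 'u) \<Rightarrow> 'u \<Rightarrow> 'u" where
  "u_map p M1 M2 N1 N2 f1 f2 =
     (\<lambda>u\<in>carrier (u_prod p M1 M2). into p N1 N2 (zmap M1 M2 N1 N2 f1 f2 (out p M1 M2 u)))"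

definition u_assoc ::
  "('u \<times> 'u \<Rightarrow> 'u) \<Rightarrow> ('g::ab_group_add, 'u) cgset \<Rightarrow> ('g, 'u) cgset \<Rightarrow> ('g, 'u) cgset \<Rightarrow> 'u \<Rightarrow> 'u" where
  "u_assoc p M1 M2 M3 =
     (\<lambda>u\<in>carrier (u_prod p (u_prod p M1 M2) M3).
        into p M1 (u_prod p M2 M3)
          (zmap M1 (M2 \<times>\<^sub>z M3) M1 (u_prod p M2 M3) (cg_id M1) (into p M2 M3)
            (zassoc M1 M2 M3
              (zmap (u_prod p M1 M2) M3 (M1 \<times>\<^sub>z M2) M3 (out p M1 M2) (cg_id M3)
                (out p (u_prod p M1 M2) M3 u)))))"

definition u_lunit ::
  "('u \<times> 'u \<Rightarrow> 'u) \<Rightarrow> ('g::ab_group_add \<Rightarrow> 'u) \<Rightarrow> ('g, 'u) cgset \<Rightarrow> 'u \<Rightarrow> 'u" where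
  "u_lunit p e M =
     (\<lambda>u\<in>carrier (u_prod p (u_unit e) M).
        zlunit M (zmap (u_unit e) M zunit M (out_unit e) (cg_id M) (out p (u_unit e) M u)))"

definition u_runit ::
  "('u \<times> 'u \<Rightarrow> 'u) \<Rightarrow> ('g::ab_group_add \<Rightarrow> 'u) \<Rightarrow> ('g, 'u) cgset \<Rightarrow> 'u \<Rightarrow> 'u" where
  "u_runit p e M =
     (\<lambda>u\<in>carrier (u_prod p M (u_unit e)).
        zrunit M (zmap M (u_unit e) M zunit (cg_id M) (out_unit e) (out p M (u_unit e) u)))"

end

theory Submission
  imports Defs
begin

text \<open>Since the group acts invertibly, the generating relation is already an equivalence:
  \<open>[m, n] = [m', n']\<close> iff \<open>m = x.m'\<close> and \<open>n' = x.n\<close> for a single \<open>x\<close>. With this criterion both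
  \<open>[[a, b], c] = [[a', b'], c']\<close> and \<open>[a, [b, c]] = [a', [b', c']]\<close> say that \<open>a = y.a'\<close>,
  \<open>b' = (x + y).b\<close> and \<open>c = x.c'\<close> for some \<open>x\<close> and \<open>y\<close>, so rebracketing is well defined and
  injective. Every coherence law is then an equality of maps that agree on classes of tuples. The
  copies inside a universe type satisfy the same laws because a coded class \<open>u_pair\<close> obeys the same
  computation rules as the class itself.\<close>

section \<open>Centrally graded sets and their morphisms\<close>

lemma centrally_gradedI:
  assumes "deg M \<in> extensional (carrier M)"
    and "\<And>x. act M x \<in> extensional (carrier M)"
    and "\<And>x m. m \<in> carrier M \<Longrightarrow> act M x m \<in> carrier M"
    and "\<And>m. m \<in> carrier M \<Longrightarrow> act M 0 m = m"
    and "\<And>x y m. m \<in> carrier M \<Longrightarrow> act M (x + y) m = act M x (act M y m)"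
    and "\<And>x m. m \<in> carrier M \<Longrightarrow> deg M (act M x m) = deg M m"
  shows "centrally_graded M"
  using assms unfolding centrally_graded_def PiE_def by blast

lemma act_closed [simp]: "\<lbrakk>centrally_graded M; m \<in> carrier M\<rbrakk> \<Longrightarrow> act M x m \<in> carrier M"
  unfolding centrally_graded_def by blast

lemma act_zero [simp]: "\<lbrakk>centrally_graded M; m \<in> carrier M\<rbrakk> \<Longrightarrow> act M 0 m = m"
  unfolding centrally_graded_def by blast

lemma act_act [simp]:
  "\<lbrakk>centrally_graded M; m \<in> carrier M\<rbrakk> \<Longrightarrow> act M x (act M y m) = act M (x + y) m"
  unfolding centrally_graded_def by simp

lemma deg_act [simp]: "\<lbrakk>centrally_graded M; m \<in> carrier M\<rbrakk> \<Longrightarrow> deg M (act M x m) = deg M m"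
  unfolding centrally_graded_def by blast

lemma cg_homI:
  assumes "f \<in> extensional (carrier M)"
    and "\<And>m. m \<in> carrier M \<Longrightarrow> f m \<in> carrier N"
    and "\<And>m. m \<in> carrier M \<Longrightarrow> deg N (f m) = deg M m"
    and "\<And>x m. m \<in> carrier M \<Longrightarrow> f (act M x m) = act N x (f m)"
  shows "f \<in> cg_hom M N"
  using assms unfolding cg_hom_def PiE_def by blast

lemma cg_hom_closed [simp]: "\<lbrakk>f \<in> cg_hom M N; m \<in> carrier M\<rbrakk> \<Longrightarrow> f m \<in> carrier N"
  unfolding cg_hom_def by blast

lemma cg_hom_deg [simp]: "\<lbrakk>f \<in> cg_hom M N; m \<in> carrier M\<rbrakk> \<Longrightarrow> deg N (f m) = deg M m"
  unfolding cg_hom_def by blast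

lemma cg_hom_act [simp]: "\<lbrakk>f \<in> cg_hom M N; m \<in> carrier M\<rbrakk> \<Longrightarrow> f (act M x m) = act N x (f m)"
  unfolding cg_hom_def by blast

lemma cg_hom_extensional [simp]: "f \<in> cg_hom M N \<Longrightarrow> f \<in> extensional (carrier M)"
  unfolding cg_hom_def PiE_def by blast

lemma cg_id_apply [simp]: "m \<in> carrier M \<Longrightarrow> cg_id M m = m"
  by (simp add: cg_id_def)

lemma cg_id_extensional [simp]: "cg_id M \<in> extensional (carrier M)"
  by (simp add: cg_id_def)

lemma cg_id_hom [simp]: "centrally_graded M \<Longrightarrow> cg_id M \<in> cg_hom M M"
  by (rule cg_homI) simp_all

lemma cg_compose_hom [simp]:
  assumes "centrally_graded M" "f \<in> cg_hom M N" "g \<in> cg_hom N P"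
  shows "compose (carrier M) g f \<in> cg_hom M P"
  using assms by (intro cg_homI) (simp_all add: compose_eq compose_extensional)

lemma cg_compose_id_right [simp]: "f \<in> cg_hom M N \<Longrightarrow> compose (carrier M) f (cg_id M) = f"
  by (rule extensionalityI [of _ "carrier M"]) (simp_all add: compose_eq compose_extensional)

lemma cg_compose_id_left [simp]: "f \<in> cg_hom M N \<Longrightarrow> compose (carrier M) (cg_id N) f = f"
  by (rule extensionalityI [of _ "carrier M"]) (simp_all add: compose_eq compose_extensional)

lemma cg_compose_assoc:
  "f \<in> cg_hom M N \<Longrightarrow> compose (carrier M) h (compose (carrier M) g f) =
     compose (carrier M) (compose (carrier N) h g) f"
  by (rule extensionalityI [of _ "carrier M"]) (simp_all add: compose_eq compose_extensional)

text \<open>The inverse of a bijective morphism is automatically a morphism: each condition at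
  \<open>n\<close> is checked after writing \<open>n = f m\<close>. Isomorphy is thereby reduced to
  bijectivity.\<close>

lemma cg_isoI:
  assumes "centrally_graded M" and f: "f \<in> cg_hom M N" and inj: "inj_on f (carrier M)"
    and surj: "\<And>n. n \<in> carrier N \<Longrightarrow> \<exists>m\<in>carrier M. f m = n"
  shows "cg_iso M N f"
proof -
  define g where "g = restrict (inv_into (carrier M) f) (carrier N)"
  have gf [simp]: "g (f m) = m" if "m \<in> carrier M" for m
    using that f inj by (simp add: g_def)
  \<comment> \<open>This is \<open>cg_hom_act\<close> reversed, so that \<open>gf\<close> can cancel
    \<open>g\<close> against \<open>f\<close>. Where it serves as a rewrite rule, the membership of
    \<open>f\<close> in \<open>cg_hom M N\<close> is not supplied, since \<open>cg_hom_act\<close>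
    would then undo the step.\<close>
  have fact: "act N x (f m) = f (act M x m)" if "m \<in> carrier M" for x m
    using that f by simp
  have "g \<in> cg_hom N M"
  proof (rule cg_homI)
    show "g \<in> extensional (carrier N)" by (simp add: g_def)
  next
    fix n assume "n \<in> carrier N"
    with surj obtain m where "m \<in> carrier M" "f m = n" by blast
    then show "g n \<in> carrier M" by auto
  next
    fix n assume "n \<in> carrier N"
    with surj obtain m where "m \<in> carrier M" "n = f m" by blast
    then show "deg M (g n) = deg N n" using f by simp
  next
    fix x n assume "n \<in> carrier N"
    with surj obtain m where "m \<in> carrier M" "n = f m" by blast
    then show "g (act N x n) = act M x (g n)" using assms(1) by (simp add: fact)
  qed
  moreover have "compose (carrier M) g f = cg_id M"
    by (rule extensionalityI [of _ "carrier M"]) (simp_all add: compose_eq compose_extensional)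
  moreover have "compose (carrier N) f g = cg_id N"
    by (rule extensionalityI [of _ "carrier N"])
      (auto simp: compose_eq compose_extensional dest!: surj)
  ultimately show ?thesis using f unfolding cg_iso_def by blast
qed

section \<open>The product\<close>

lemma zrel_iff:
  "((m, n), (m', n')) \<in> zrel M N \<longleftrightarrow>
     m' \<in> carrier M \<and> n \<in> carrier N \<and> (\<exists>x. m = act M x m' \<and> n' = act N x n)"
  unfolding zrel_def by auto

text \<open>Reflexivity, symmetry and transitivity are witnessed by the group elements
  \<open>0\<close>, \<open>- x\<close> and \<open>x + y\<close>, so no closure has to be
  taken.\<close>

lemma equiv_zrel [simp]:
  assumes "centrally_graded M" "centrally_graded N"
  shows "equiv (carrier M \<times> carrier N) (zrel M N)"
proof (rule equivI)
  show "zrel M N \<subseteq> (carrier M \<times> carrier N) \<times> (carrier M \<times> carrier N)"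
    using assms by (auto simp: zrel_def)
  show "refl_on (carrier M \<times> carrier N) (zrel M N)"
    using assms by (auto simp: refl_on_def zrel_iff intro!: exI [of _ 0])
  show "sym (zrel M N)"
  proof (rule symI)
    fix a b assume "(a, b) \<in> zrel M N"
    then obtain x m n where "m \<in> carrier M" "n \<in> carrier N"
      "a = (act M x m, n)" "b = (m, act N x n)"
      unfolding zrel_def by blast
    then show "(b, a) \<in> zrel M N"
      using assms by (auto simp: zrel_iff intro!: exI [of _ "- x"])
  qed
  show "trans (zrel M N)"
  proof (rule transI)
    fix a b c assume "(a, b) \<in> zrel M N" "(b, c) \<in> zrel M N"
    then obtain x m n y m' n' where *: "m \<in> carrier M" "n \<in> carrier N" "m' \<in> carrier M"
      "n' \<in> carrier N" "a = (act M x m, n)" "b = (m, act N x n)"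
      "b = (act M y m', n')" "c = (m', act N y n')"
      unfolding zrel_def by blast
    \<comment> \<open>The two descriptions of \<open>b\<close> are compared. Composing the moves
      puts \<open>x + y\<close> on the first component and \<open>y + x\<close> on the second;
      commutativity makes this a single move.\<close>
    then have "m = act M y m'" "n' = act N x n" by simp_all
    with * assms show "(a, c) \<in> zrel M N"
      by (auto simp: zrel_iff add.commute intro!: exI [of _ "x + y"])
  qed
qed

text \<open>Classes of an equivalence relation agree iff their representatives are related, and
  \<open>zrel_iff\<close> then names the group element.\<close>

lemma zclass_eq_iff:
  assumes "centrally_graded M" "centrally_graded N"
    and "m \<in> carrier M" "n \<in> carrier N" "m' \<in> carrier M" "n' \<in> carrier N"
  shows "zclass M N m n = zclass M N m' n' \<longleftrightarrow> (\<exists>x. m = act M x m' \<and> n' = act N x n)"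
  using assms eq_equiv_class_iff [OF equiv_zrel, of M N "(m, n)" "(m', n')"]
  by (simp add: zclass_def zrel_iff)

text \<open>The action moves to the right in normal forms of classes.\<close>

lemma zclass_act [simp]:
  assumes "centrally_graded M" "centrally_graded N" "m \<in> carrier M" "n \<in> carrier N"
  shows "zclass M N (act M x m) n = zclass M N m (act N x n)"
  using assms by (auto simp: zclass_eq_iff)

lemma zclass_self:
  assumes "centrally_graded M" "centrally_graded N" "m \<in> carrier M" "n \<in> carrier N"
  shows "(m, n) \<in> zclass M N m n"
  using equiv_class_self [OF equiv_zrel [of M N], of "(m, n)"] assms by (simp add: zclass_def)

lemma carrier_zprod: "carrier (M \<times>\<^sub>z N) = (carrier M \<times> carrier N) // zrel M N"
  by (simp add: zprod_def)

lemma zclass_closed [simp]: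
  "\<lbrakk>m \<in> carrier M; n \<in> carrier N\<rbrakk> \<Longrightarrow> zclass M N m n \<in> carrier (M \<times>\<^sub>z N)"
  by (simp add: carrier_zprod zclass_def quotientI)

lemma zprodE:
  assumes "X \<in> carrier (M \<times>\<^sub>z N)"
  obtains m n where "m \<in> carrier M" "n \<in> carrier N" "X = zclass M N m n"
  using assms by (auto simp: carrier_zprod zclass_def elim!: quotientE)

text \<open>Tool for identities between maps out of a product: off the carrier both sides are
  \<open>undefined\<close>, and on it only classes of pairs have to be compared.\<close>

lemma zprod_fun_eqI:
  assumes "f \<in> extensional (carrier (M \<times>\<^sub>z N))" "g \<in> extensional (carrier (M \<times>\<^sub>z N))"
    and "\<And>m n. \<lbrakk>m \<in> carrier M; n \<in> carrier N\<rbrakk> \<Longrightarrow> f (zclass M N m n) = g (zclass M N m n)"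
  shows "f = g"
  using assms(1,2) by (rule extensionalityI) (auto simp: assms(3) elim!: zprodE)

section \<open>Evaluation of maps defined through representatives\<close>

lemma the_elem_image_class:
  assumes "equiv A r" "f respects r" "a \<in> A"
  shows "the_elem (f ` (r `` {a})) = f a"
proof -
  have "f ` (r `` {a}) = {f a}"
    using assms equiv_class_self [OF assms(1,3)] by (fastforce simp: congruent_def)
  then show ?thesis by simp
qed

text \<open>\<open>zrel\<close> contains nothing beyond the generating pairs, so invariance under
  one move suffices.\<close>

lemma respects_zrelI:
  assumes "\<And>x m n. \<lbrakk>m \<in> carrier M; n \<in> carrier N\<rbrakk> \<Longrightarrow> f (act M x m, n) = f (m, act N x n)"
  shows "f respects zrel M N"
  using assms by (auto simp: zrel_def intro!: congruentI)

text \<open>The image of a class under an invariant \<open>f\<close> is a singleton, so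
  \<open>the_elem\<close> returns the value at any representative. This evaluates
  \<open>deg\<close>, \<open>act\<close>, \<open>zmap\<close>, \<open>zlunit\<close> and
  \<open>zrunit\<close>.\<close>

lemma the_elem_image_zclass:
  assumes "centrally_graded M" "centrally_graded N" "m \<in> carrier M" "n \<in> carrier N"
    and "\<And>x m n. \<lbrakk>m \<in> carrier M; n \<in> carrier N\<rbrakk> \<Longrightarrow> f (act M x m, n) = f (m, act N x n)"
  shows "the_elem (f ` zclass M N m n) = f (m, n)"
proof -
  have "f respects zrel M N"
    using assms(5) by (rule respects_zrelI)
  with assms show ?thesis
    unfolding zclass_def by (intro the_elem_image_class [of "carrier M \<times> carrier N"]) simp_all
qed

lemma deg_respects_zrel:
  assumes "centrally_graded M" "centrally_graded N"
  shows "(\<lambda>(m, n). deg M m + deg N n) respects zrel M N"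
  using assms by (intro respects_zrelI) simp

lemma act_respects_zrel:
  assumes "centrally_graded M" "centrally_graded N"
  shows "(\<lambda>(m, n). zclass M N (act M x m) n) respects zrel M N"
  using assms by (intro respects_zrelI) (simp add: add.commute)

lemma deg_zprod [simp]:
  assumes "centrally_graded M" "centrally_graded N" "m \<in> carrier M" "n \<in> carrier N"
  shows "deg (M \<times>\<^sub>z N) (zclass M N m n) = deg M m + deg N n"
proof -
  have "deg (M \<times>\<^sub>z N) (zclass M N m n) =
      the_elem ((\<lambda>(m, n). deg M m + deg N n) ` zclass M N m n)"
    using zclass_closed [OF assms(3,4)] by (simp add: zprod_def)
  also have "\<dots> = deg M m + deg N n"
    using assms by (subst the_elem_image_zclass) auto
  finally show ?thesis .
qed

text \<open>The definition acts on the first component; the rule is stated with the second one to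
  match the normal form produced by \<open>zclass_act\<close>.\<close>

lemma act_zprod [simp]:
  assumes "centrally_graded M" "centrally_graded N" "m \<in> carrier M" "n \<in> carrier N"
  shows "act (M \<times>\<^sub>z N) x (zclass M N m n) = zclass M N m (act N x n)"
proof -
  have "act (M \<times>\<^sub>z N) x (zclass M N m n) =
      the_elem ((\<lambda>(m, n). zclass M N (act M x m) n) ` zclass M N m n)"
    using zclass_closed [OF assms(3,4)] by (simp add: zprod_def)
  also have "\<dots> = zclass M N m (act N x n)"
    using assms by (subst the_elem_image_zclass) (auto simp: add.commute)
  finally show ?thesis .
qed

lemma centrally_graded_zprod [simp]:
  assumes "centrally_graded M" "centrally_graded N"
  shows "centrally_graded (M \<times>\<^sub>z N)"
proof (rule centrally_gradedI)
  show "deg (M \<times>\<^sub>z N) \<in> extensional (carrier (M \<times>\<^sub>z N))"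
    by (simp add: zprod_def)
  show "act (M \<times>\<^sub>z N) x \<in> extensional (carrier (M \<times>\<^sub>z N))" for x
    by (simp add: zprod_def)
qed (use assms in \<open>auto elim!: zprodE\<close>)

section \<open>Functoriality of the product\<close>

lemma zmap_extensional [simp]:
  "zmap M1 M2 N1 N2 f1 f2 \<in> extensional (carrier (M1 \<times>\<^sub>z M2))"
  by (simp add: zmap_def)

text \<open>Equivariance of \<open>f1\<close> and \<open>f2\<close> carries a generating move in the
  source to one in the target, hence the choice of representative does not matter.\<close>

lemma zmap_zclass [simp]:
  assumes "centrally_graded M1" "centrally_graded M2" "centrally_graded N1" "centrally_graded N2"
    and "f1 \<in> cg_hom M1 N1" "f2 \<in> cg_hom M2 N2" "m1 \<in> carrier M1" "m2 \<in> carrier M2"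
  shows "zmap M1 M2 N1 N2 f1 f2 (zclass M1 M2 m1 m2) = zclass N1 N2 (f1 m1) (f2 m2)"
proof -
  have "zmap M1 M2 N1 N2 f1 f2 (zclass M1 M2 m1 m2) =
      the_elem ((\<lambda>(m1, m2). zclass N1 N2 (f1 m1) (f2 m2)) ` zclass M1 M2 m1 m2)"
    using assms by (simp add: zmap_def)
  also have "\<dots> = zclass N1 N2 (f1 m1) (f2 m2)"
    using assms by (subst the_elem_image_zclass) auto
  finally show ?thesis .
qed

lemma zmap_hom [simp]:
  assumes "centrally_graded M1" "centrally_graded M2" "centrally_graded N1" "centrally_graded N2"
    and "f1 \<in> cg_hom M1 N1" "f2 \<in> cg_hom M2 N2"
  shows "zmap M1 M2 N1 N2 f1 f2 \<in> cg_hom (M1 \<times>\<^sub>z M2) (N1 \<times>\<^sub>z N2)"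
  by (rule cg_homI) (use assms in \<open>auto elim!: zprodE\<close>)

lemma zmap_id:
  assumes "centrally_graded M1" "centrally_graded M2"
  shows "zmap M1 M2 M1 M2 (cg_id M1) (cg_id M2) = cg_id (M1 \<times>\<^sub>z M2)"
  by (rule zprod_fun_eqI [OF zmap_extensional cg_id_extensional]) (use assms in simp_all)

lemma zmap_compose:
  assumes "centrally_graded M1" "centrally_graded M2" "centrally_graded N1" "centrally_graded N2"
    and "centrally_graded P1" "centrally_graded P2"
    and "f1 \<in> cg_hom M1 N1" "f2 \<in> cg_hom M2 N2" "g1 \<in> cg_hom N1 P1" "g2 \<in> cg_hom N2 P2"
  shows "zmap M1 M2 P1 P2 (compose (carrier M1) g1 f1) (compose (carrier M2) g2 f2) =
    compose (carrier (M1 \<times>\<^sub>z M2)) (zmap N1 N2 P1 P2 g1 g2) (zmap M1 M2 N1 N2 f1 f2)"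
  by (rule zprod_fun_eqI [OF zmap_extensional compose_extensional])
    (use assms in \<open>simp_all add: compose_eq\<close>)

section \<open>Associativity and unit\<close>

text \<open>Left to right this makes rebracketing well defined; right to left it makes it
  injective.\<close>

lemma zassoc_eq_iff:
  assumes "centrally_graded M1" "centrally_graded M2" "centrally_graded M3"
    and "a \<in> carrier M1" "b \<in> carrier M2" "c \<in> carrier M3"
    and "a' \<in> carrier M1" "b' \<in> carrier M2" "c' \<in> carrier M3"
  shows "zclass (M1 \<times>\<^sub>z M2) M3 (zclass M1 M2 a b) c = zclass (M1 \<times>\<^sub>z M2) M3 (zclass M1 M2 a' b') c' \<longleftrightarrow>
    zclass M1 (M2 \<times>\<^sub>z M3) a (zclass M2 M3 b c) = zclass M1 (M2 \<times>\<^sub>z M3) a' (zclass M2 M3 b' c')"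
    (is "?L \<longleftrightarrow> ?R")
proof -
  \<comment> \<open>The outer criterion gives \<open>x\<close> with
    \<open>[a, b] = x.[a', b'] = [a', x.b']\<close> and \<open>c' = x.c\<close>; the inner one then
    gives \<open>y\<close>.\<close>
  have "?L \<longleftrightarrow> (\<exists>x y. a = act M1 y a' \<and> act M2 x b' = act M2 y b \<and> c' = act M3 x c)"
    using assms by (auto simp: zclass_eq_iff)
  \<comment> \<open>Replacing \<open>x\<close> by \<open>- x\<close> solves the equations for
    \<open>b'\<close> and \<open>c\<close>.\<close>
  also have "\<dots> \<longleftrightarrow> (\<exists>y x. a = act M1 y a' \<and> b' = act M2 x (act M2 y b) \<and> c = act M3 x c')"
  proof (intro iffI; elim exE conjE)
    fix x y assume *: "a = act M1 y a'" "act M2 x b' = act M2 y b" "c' = act M3 x c"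
    have "b' = act M2 (- x) (act M2 x b')" "c = act M3 (- x) (act M3 x c)"
      using assms by simp_all
    with * show "\<exists>y x. a = act M1 y a' \<and> b' = act M2 x (act M2 y b) \<and> c = act M3 x c'"
      by metis
  next
    fix x y assume *: "a = act M1 y a'" "b' = act M2 x (act M2 y b)" "c = act M3 x c'"
    have "act M2 (- x) (act M2 x (act M2 y b)) = act M2 y b" "c' = act M3 (- x) (act M3 x c')"
      using assms by simp_all
    with * show "\<exists>x y. a = act M1 y a' \<and> act M2 x b' = act M2 y b \<and> c' = act M3 x c"
      by metis
  qed
  \<comment> \<open>On the right-hand side \<open>y\<close> acts on \<open>[b, c]\<close>. Reversing
    \<open>zclass_act\<close> puts it on \<open>b\<close>, so that the inner criterion yields
    exactly these equations.\<close>
  also have "\<dots> \<longleftrightarrow> ?R"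
    using assms by (subst zclass_eq_iff) (auto simp: zclass_eq_iff simp flip: zclass_act)
  finally show ?thesis .
qed

lemma zassoc_extensional [simp]:
  "zassoc M1 M2 M3 \<in> extensional (carrier ((M1 \<times>\<^sub>z M2) \<times>\<^sub>z M3))"
  by (simp add: zassoc_def)

text \<open>A class may have many presentations by triples, but by \<open>zassoc_eq_iff\<close> all
  of them give the same rebracketed class; the set under \<open>the_elem\<close> is a
  singleton.\<close>

lemma zassoc_zclass [simp]:
  assumes "centrally_graded M1" "centrally_graded M2" "centrally_graded M3"
    and "a \<in> carrier M1" "b \<in> carrier M2" "c \<in> carrier M3"
  shows "zassoc M1 M2 M3 (zclass (M1 \<times>\<^sub>z M2) M3 (zclass M1 M2 a b) c) =
    zclass M1 (M2 \<times>\<^sub>z M3) a (zclass M2 M3 b c)"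
proof -
  let ?X = "zclass (M1 \<times>\<^sub>z M2) M3 (zclass M1 M2 a b) c"
  have "{zclass M1 (M2 \<times>\<^sub>z M3) m1 (zclass M2 M3 m2 m3) | m1 m2 m3.
      m1 \<in> carrier M1 \<and> m2 \<in> carrier M2 \<and> m3 \<in> carrier M3 \<and>
      ?X = zclass (M1 \<times>\<^sub>z M2) M3 (zclass M1 M2 m1 m2) m3} =
    {zclass M1 (M2 \<times>\<^sub>z M3) a (zclass M2 M3 b c)}"
    using assms by (auto simp: zassoc_eq_iff)
  then show ?thesis using assms by (simp add: zassoc_def)
qed

lemma zassoc_hom [simp]:
  assumes "centrally_graded M1" "centrally_graded M2" "centrally_graded M3"
  shows "zassoc M1 M2 M3 \<in> cg_hom ((M1 \<times>\<^sub>z M2) \<times>\<^sub>z M3) (M1 \<times>\<^sub>z (M2 \<times>\<^sub>z M3))"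
  by (rule cg_homI) (use assms in \<open>auto simp: add.assoc elim!: zprodE\<close>)

text \<open>Injectivity is the converse half of \<open>zassoc_eq_iff\<close>; a preimage of
  \<open>[a, [b, c]]\<close> is \<open>[[a, b], c]\<close>.\<close>

lemma zassoc_iso:
  assumes "centrally_graded M1" "centrally_graded M2" "centrally_graded M3"
  shows "cg_iso ((M1 \<times>\<^sub>z M2) \<times>\<^sub>z M3) (M1 \<times>\<^sub>z (M2 \<times>\<^sub>z M3)) (zassoc M1 M2 M3)"
proof (rule cg_isoI)
  show "inj_on (zassoc M1 M2 M3) (carrier ((M1 \<times>\<^sub>z M2) \<times>\<^sub>z M3))"
    using assms by (intro inj_onI; elim zprodE) (simp add: zassoc_eq_iff)
  show "\<exists>X\<in>carrier ((M1 \<times>\<^sub>z M2) \<times>\<^sub>z M3). zassoc M1 M2 M3 X = Y"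
    if "Y \<in> carrier (M1 \<times>\<^sub>z (M2 \<times>\<^sub>z M3))" for Y
    using that assms by (metis zassoc_zclass zclass_closed zprodE)
qed (use assms in simp_all)

lemma zassoc_natural:
  assumes "centrally_graded M1" "centrally_graded M2" "centrally_graded M3"
    and "centrally_graded N1" "centrally_graded N2" "centrally_graded N3"
    and "f1 \<in> cg_hom M1 N1" "f2 \<in> cg_hom M2 N2" "f3 \<in> cg_hom M3 N3"
  shows "compose (carrier ((M1 \<times>\<^sub>z M2) \<times>\<^sub>z M3)) (zassoc N1 N2 N3)
        (zmap (M1 \<times>\<^sub>z M2) M3 (N1 \<times>\<^sub>z N2) N3 (zmap M1 M2 N1 N2 f1 f2) f3) =
      compose (carrier ((M1 \<times>\<^sub>z M2) \<times>\<^sub>z M3))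
        (zmap M1 (M2 \<times>\<^sub>z M3) N1 (N2 \<times>\<^sub>z N3) f1 (zmap M2 M3 N2 N3 f2 f3)) (zassoc M1 M2 M3)"
  by (rule zprod_fun_eqI [OF compose_extensional compose_extensional])
    (use assms in \<open>auto simp: compose_eq elim!: zprodE\<close>)

text \<open>Both composites send \<open>[[[a, b], c], d]\<close> to
  \<open>[a, [b, [c, d]]]\<close>.\<close>

lemma pentagon_zassoc:
  assumes "centrally_graded M1" "centrally_graded M2" "centrally_graded M3" "centrally_graded M4"
  shows "compose (carrier (((M1 \<times>\<^sub>z M2) \<times>\<^sub>z M3) \<times>\<^sub>z M4))
     (zassoc M1 M2 (M3 \<times>\<^sub>z M4)) (zassoc (M1 \<times>\<^sub>z M2) M3 M4) =
   compose (carrier (((M1 \<times>\<^sub>z M2) \<times>\<^sub>z M3) \<times>\<^sub>z M4))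
     (zmap M1 ((M2 \<times>\<^sub>z M3) \<times>\<^sub>z M4) M1 (M2 \<times>\<^sub>z (M3 \<times>\<^sub>z M4)) (cg_id M1) (zassoc M2 M3 M4))
     (compose (carrier (((M1 \<times>\<^sub>z M2) \<times>\<^sub>z M3) \<times>\<^sub>z M4))
       (zassoc M1 (M2 \<times>\<^sub>z M3) M4)
       (zmap ((M1 \<times>\<^sub>z M2) \<times>\<^sub>z M3) M4 (M1 \<times>\<^sub>z (M2 \<times>\<^sub>z M3)) M4 (zassoc M1 M2 M3) (cg_id M4)))"
  by (rule zprod_fun_eqI [OF compose_extensional compose_extensional])
    (use assms in \<open>auto simp: compose_eq elim!: zprodE\<close>)

section \<open>The unit object\<close>

lemma zunit_simps [simp]:
  "carrier zunit = UNIV" "deg zunit m = 0" "act zunit x m = x + m"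
  by (simp_all add: zunit_def)

lemma centrally_graded_zunit [simp]: "centrally_graded zunit"
  by (rule centrally_gradedI) (simp_all add: add.assoc)

lemma zlunit_extensional [simp]: "zlunit M \<in> extensional (carrier (zunit \<times>\<^sub>z M))"
  by (simp add: zlunit_def)

lemma zrunit_extensional [simp]: "zrunit M \<in> extensional (carrier (M \<times>\<^sub>z zunit))"
  by (simp add: zrunit_def)

text \<open>Invariance under a move by \<open>y\<close> compares \<open>(y + x).m\<close> with
  \<open>x.(y.m)\<close>, so it rests on commutativity of the group.\<close>

lemma zlunit_zclass [simp]:
  assumes "centrally_graded M" "m \<in> carrier M"
  shows "zlunit M (zclass zunit M x m) = act M x m"
  using assms by (simp add: zlunit_def the_elem_image_zclass add.commute)

lemma zrunit_zclass [simp]: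
  assumes "centrally_graded M" "m \<in> carrier M"
  shows "zrunit M (zclass M zunit m x) = act M x m"
  using assms by (simp add: zrunit_def the_elem_image_zclass add.commute)

text \<open>Supplies the group element that relates two classes with the same image under a unit
  map; it comes from cancelling \<open>y\<close>.\<close>

lemma act_eq_actD:
  assumes "centrally_graded M" "m \<in> carrier M" "n \<in> carrier M" "act M x m = act M y n"
  shows "n = act M (x - y) m"
proof -
  have "n = act M (- y) (act M y n)" using assms by simp
  also have "\<dots> = act M (- y) (act M x m)" by (simp only: assms(4))
  finally show ?thesis using assms(1,2) by simp
qed

lemma zlunit_hom [simp]: "centrally_graded M \<Longrightarrow> zlunit M \<in> cg_hom (zunit \<times>\<^sub>z M) M"
  by (rule cg_homI) (auto simp: add.commute elim!: zprodE)

lemma zrunit_hom [simp]: "centrally_graded M \<Longrightarrow> zrunit M \<in> cg_hom (M \<times>\<^sub>z zunit) M"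
  by (rule cg_homI) (auto elim!: zprodE)

lemma zlunit_iso:
  assumes "centrally_graded M"
  shows "cg_iso (zunit \<times>\<^sub>z M) M (zlunit M)"
proof (rule cg_isoI)
  show "inj_on (zlunit M) (carrier (zunit \<times>\<^sub>z M))"
  proof (rule inj_onI, elim zprodE)
    fix X Y x m y n
    assume *: "m \<in> carrier M" "n \<in> carrier M" "X = zclass zunit M x m" "Y = zclass zunit M y n"
      and "zlunit M X = zlunit M Y"
    then have "n = act M (x - y) m" using assms by (auto intro!: act_eq_actD)
    \<comment> \<open>The same element also relates the first components, because
      \<open>x = (x - y) + y\<close>.\<close>
    with * assms show "X = Y" by (auto simp: zclass_eq_iff intro!: exI [of _ "x - y"])
  qed
  show "\<exists>X\<in>carrier (zunit \<times>\<^sub>z M). zlunit M X = m" if "m \<in> carrier M" for m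
    using that assms by (intro bexI [of _ "zclass zunit M 0 m"]) simp_all
qed (use assms in simp_all)

lemma zrunit_iso:
  assumes "centrally_graded M"
  shows "cg_iso (M \<times>\<^sub>z zunit) M (zrunit M)"
proof (rule cg_isoI)
  show "inj_on (zrunit M) (carrier (M \<times>\<^sub>z zunit))"
  proof (rule inj_onI, elim zprodE)
    fix X Y x m y n
    assume *: "m \<in> carrier M" "n \<in> carrier M" "X = zclass M zunit m x" "Y = zclass M zunit n y"
      and "zrunit M X = zrunit M Y"
    then have "m = act M (y - x) n" using assms by (intro act_eq_actD) simp_all
    \<comment> \<open>With the unit on the right the criterion asks for \<open>y = z + x\<close>, so
      the witness is \<open>y - x\<close>.\<close>
    with * assms show "X = Y" by (auto simp: zclass_eq_iff intro!: exI [of _ "y - x"])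
  qed
  show "\<exists>X\<in>carrier (M \<times>\<^sub>z zunit). zrunit M X = m" if "m \<in> carrier M" for m
    using that assms by (intro bexI [of _ "zclass M zunit m 0"]) simp_all
qed (use assms in simp_all)

lemma zlunit_natural:
  assumes "centrally_graded M" "centrally_graded N" "f \<in> cg_hom M N"
  shows "compose (carrier (zunit \<times>\<^sub>z M)) (zlunit N) (zmap zunit M zunit N (cg_id zunit) f) =
    compose (carrier (zunit \<times>\<^sub>z M)) f (zlunit M)"
  by (rule zprod_fun_eqI [OF compose_extensional compose_extensional])
    (use assms in \<open>auto simp: compose_eq elim!: zprodE\<close>)

lemma zrunit_natural:
  assumes "centrally_graded M" "centrally_graded N" "f \<in> cg_hom M N"
  shows "compose (carrier (M \<times>\<^sub>z zunit)) (zrunit N) (zmap M zunit N zunit f (cg_id zunit)) =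
    compose (carrier (M \<times>\<^sub>z zunit)) f (zrunit M)"
  by (rule zprod_fun_eqI [OF compose_extensional compose_extensional])
    (use assms in \<open>auto simp: compose_eq elim!: zprodE\<close>)

text \<open>On \<open>[[a, x], b]\<close> the two sides give \<open>[a, x.b]\<close> and
  \<open>[x.a, b]\<close>, which are identified by the defining relation.\<close>

lemma triangle_zunit:
  assumes "centrally_graded M1" "centrally_graded M2"
  shows "compose (carrier ((M1 \<times>\<^sub>z zunit) \<times>\<^sub>z M2))
     (zmap M1 (zunit \<times>\<^sub>z M2) M1 M2 (cg_id M1) (zlunit M2)) (zassoc M1 zunit M2) =
   zmap (M1 \<times>\<^sub>z zunit) M2 M1 M2 (zrunit M1) (cg_id M2)"
  by (rule zprod_fun_eqI [OF compose_extensional zmap_extensional])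
    (use assms in \<open>auto simp: compose_eq elim!: zprodE\<close>)

section \<open>The product in a fixed universe type\<close>

lemma carrier_transport [simp]: "carrier (transport j M) = j ` carrier M"
  by (simp add: transport_def)

lemma deg_transport [simp]:
  "\<lbrakk>inj_on j (carrier M); m \<in> carrier M\<rbrakk> \<Longrightarrow> deg (transport j M) (j m) = deg M m"
  by (simp add: transport_def)

lemma act_transport [simp]:
  "\<lbrakk>inj_on j (carrier M); m \<in> carrier M\<rbrakk> \<Longrightarrow> act (transport j M) x (j m) = j (act M x m)"
  by (simp add: transport_def)

lemma centrally_graded_transport:
  assumes "inj_on j (carrier M)" "centrally_graded M"
  shows "centrally_graded (transport j M)"
proof (rule centrally_gradedI)
  show "deg (transport j M) \<in> extensional (carrier (transport j M))"
    by (simp add: transport_def)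
  show "act (transport j M) x \<in> extensional (carrier (transport j M))" for x
    by (simp add: transport_def)
qed (use assms in auto)

text \<open>Equal codes mean that the same representative was chosen, so the two classes meet;
  classes that meet are equal.\<close>

lemma inj_on_code:
  assumes "inj p" "centrally_graded M" "centrally_graded N"
  shows "inj_on (code p) (carrier (M \<times>\<^sub>z N))"
proof (rule inj_onI)
  fix X Y assume XY: "X \<in> carrier (M \<times>\<^sub>z N)" "Y \<in> carrier (M \<times>\<^sub>z N)" and "code p X = code p Y"
  then have eq: "(SOME q. q \<in> X) = (SOME q. q \<in> Y)"
    using assms(1) by (simp add: code_def inj_eq)
  \<comment> \<open>Classes are nonempty, so the chosen pair really lies in its class.\<close>
  have "(SOME q. q \<in> Z) \<in> Z" if "Z \<in> carrier (M \<times>\<^sub>z N)" for Z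
    using that assms(2,3) zclass_self by (metis someI zprodE)
  then have "X \<inter> Y \<noteq> {}" using XY eq by (metis disjoint_iff)
  then show "X = Y"
    using quotient_disj [OF equiv_zrel] XY assms unfolding carrier_zprod by blast
qed

text \<open>The universe counterpart of \<open>[m, n]\<close>. Stating all rules through it keeps
  the arbitrary representative chosen by \<open>code\<close> out of sight.\<close>

definition u_pair ::
  "('u \<times> 'u \<Rightarrow> 'u) \<Rightarrow> ('g::ab_group_add, 'u) cgset \<Rightarrow> ('g, 'u) cgset \<Rightarrow> 'u \<Rightarrow> 'u \<Rightarrow> 'u" where
  "u_pair p M N m n = code p (zclass M N m n)"

lemma u_pair_closed [simp]:
  "\<lbrakk>m \<in> carrier M; n \<in> carrier N\<rbrakk> \<Longrightarrow> u_pair p M N m n \<in> carrier (u_prod p M N)"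
  by (simp add: u_prod_def u_pair_def)

lemma u_prodE:
  assumes "u \<in> carrier (u_prod p M N)"
  obtains m n where "m \<in> carrier M" "n \<in> carrier N" "u = u_pair p M N m n"
  using assms by (auto simp: u_prod_def u_pair_def elim!: zprodE)

lemma u_prod_fun_eqI:
  assumes "f \<in> extensional (carrier (u_prod p M N))" "g \<in> extensional (carrier (u_prod p M N))"
    and "\<And>m n. \<lbrakk>m \<in> carrier M; n \<in> carrier N\<rbrakk> \<Longrightarrow> f (u_pair p M N m n) = g (u_pair p M N m n)"
  shows "f = g"
  using assms(1,2) by (rule extensionalityI) (auto simp: assms(3) elim!: u_prodE)

lemma centrally_graded_u_unit [simp]: "inj e \<Longrightarrow> centrally_graded (u_unit e)"
  by (simp add: u_unit_def centrally_graded_transport)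

lemma u_unit_simps [simp]:
  "carrier (u_unit e) = range e"
  "inj e \<Longrightarrow> deg (u_unit e) (e x) = 0"
  "inj e \<Longrightarrow> act (u_unit e) y (e x) = e (y + x)"
  by (simp_all add: u_unit_def)

lemma out_unit_apply [simp]: "inj e \<Longrightarrow> out_unit e (e x) = x"
  by (simp add: out_unit_def)

lemma out_unit_hom [simp]: "inj e \<Longrightarrow> out_unit e \<in> cg_hom (u_unit e) zunit"
  by (rule cg_homI) (auto simp: out_unit_def inj_eq)

section \<open>Structure maps on coded classes\<close>

context
  fixes p :: "'u \<times> 'u \<Rightarrow> 'u"
  assumes inj_p: "inj p"
begin

lemma centrally_graded_u_prod [simp]:
  "\<lbrakk>centrally_graded M; centrally_graded N\<rbrakk> \<Longrightarrow> centrally_graded (u_prod p M N)"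
  unfolding u_prod_def by (simp add: centrally_graded_transport inj_on_code inj_p)

lemma deg_u_prod [simp]:
  "\<lbrakk>centrally_graded M; centrally_graded N; m \<in> carrier M; n \<in> carrier N\<rbrakk> \<Longrightarrow>
     deg (u_prod p M N) (u_pair p M N m n) = deg M m + deg N n"
  unfolding u_prod_def u_pair_def by (simp add: inj_on_code inj_p)

lemma act_u_prod [simp]:
  "\<lbrakk>centrally_graded M; centrally_graded N; m \<in> carrier M; n \<in> carrier N\<rbrakk> \<Longrightarrow>
     act (u_prod p M N) x (u_pair p M N m n) = u_pair p M N m (act N x n)"
  unfolding u_prod_def u_pair_def by (simp add: inj_on_code inj_p)

lemma u_pair_eq_iff:
  "\<lbrakk>centrally_graded M; centrally_graded N; m \<in> carrier M; n \<in> carrier N;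
    m' \<in> carrier M; n' \<in> carrier N\<rbrakk> \<Longrightarrow>
     u_pair p M N m n = u_pair p M N m' n' \<longleftrightarrow> zclass M N m n = zclass M N m' n'"
  unfolding u_pair_def by (rule inj_on_eq_iff [OF inj_on_code [of p M N]]) (simp_all add: inj_p)

lemma u_pair_act [simp]:
  "\<lbrakk>centrally_graded M; centrally_graded N; m \<in> carrier M; n \<in> carrier N\<rbrakk> \<Longrightarrow>
     u_pair p M N (act M x m) n = u_pair p M N m (act N x n)"
  by (simp add: u_pair_eq_iff)

lemma into_zclass [simp]:
  "\<lbrakk>m \<in> carrier M; n \<in> carrier N\<rbrakk> \<Longrightarrow> into p M N (zclass M N m n) = u_pair p M N m n"
  by (simp add: into_def u_pair_def)

lemma out_u_pair [simp]:
  "\<lbrakk>centrally_graded M; centrally_graded N; m \<in> carrier M; n \<in> carrier N\<rbrakk> \<Longrightarrow>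
     out p M N (u_pair p M N m n) = zclass M N m n"
  \<comment> \<open>\<open>u_pair\<close> stays folded at first so that \<open>u_pair_closed\<close>
    settles membership in the carrier; then it is opened to cancel the inverse of
    \<open>code p\<close>.\<close>
  by (simp add: out_def) (simp add: u_pair_def inv_into_f_f inj_on_code inj_p)

lemma into_hom [simp]:
  assumes "centrally_graded M" "centrally_graded N"
  shows "into p M N \<in> cg_hom (M \<times>\<^sub>z N) (u_prod p M N)"
proof (rule cg_homI)
  show "into p M N \<in> extensional (carrier (M \<times>\<^sub>z N))" by (simp add: into_def)
qed (use assms in \<open>auto elim!: zprodE\<close>)

lemma out_hom [simp]:
  assumes "centrally_graded M" "centrally_graded N"
  shows "out p M N \<in> cg_hom (u_prod p M N) (M \<times>\<^sub>z N)"
proof (rule cg_homI)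
  show "out p M N \<in> extensional (carrier (u_prod p M N))" by (simp add: out_def)
qed (use assms in \<open>auto elim!: u_prodE\<close>)

lemma u_map_extensional [simp]:
  "u_map p M1 M2 N1 N2 f1 f2 \<in> extensional (carrier (u_prod p M1 M2))"
  by (simp add: u_map_def)

lemma u_map_u_pair [simp]:
  "\<lbrakk>centrally_graded M1; centrally_graded M2; centrally_graded N1; centrally_graded N2;
    f1 \<in> cg_hom M1 N1; f2 \<in> cg_hom M2 N2; m1 \<in> carrier M1; m2 \<in> carrier M2\<rbrakk> \<Longrightarrow>
     u_map p M1 M2 N1 N2 f1 f2 (u_pair p M1 M2 m1 m2) = u_pair p N1 N2 (f1 m1) (f2 m2)"
  by (simp add: u_map_def)

lemma u_map_hom [simp]:
  assumes "centrally_graded M1" "centrally_graded M2" "centrally_graded N1" "centrally_graded N2"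
    and "f1 \<in> cg_hom M1 N1" "f2 \<in> cg_hom M2 N2"
  shows "u_map p M1 M2 N1 N2 f1 f2 \<in> cg_hom (u_prod p M1 M2) (u_prod p N1 N2)"
  by (rule cg_homI) (use assms in \<open>auto elim!: u_prodE\<close>)

lemma u_assoc_extensional [simp]:
  "u_assoc p M1 M2 M3 \<in> extensional (carrier (u_prod p (u_prod p M1 M2) M3))"
  by (simp add: u_assoc_def)

text \<open>The definition decodes the outer and the inner class, rebrackets, and encodes the inner
  and the outer class again; each stage has its own rewrite rule.\<close>

lemma u_assoc_u_pair [simp]:
  "\<lbrakk>centrally_graded M1; centrally_graded M2; centrally_graded M3;
    a \<in> carrier M1; b \<in> carrier M2; c \<in> carrier M3\<rbrakk> \<Longrightarrow>
     u_assoc p M1 M2 M3 (u_pair p (u_prod p M1 M2) M3 (u_pair p M1 M2 a b) c) =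
     u_pair p M1 (u_prod p M2 M3) a (u_pair p M2 M3 b c)"
  by (simp add: u_assoc_def)

lemma u_assoc_hom [simp]:
  assumes "centrally_graded M1" "centrally_graded M2" "centrally_graded M3"
  shows "u_assoc p M1 M2 M3 \<in>
    cg_hom (u_prod p (u_prod p M1 M2) M3) (u_prod p M1 (u_prod p M2 M3))"
  by (rule cg_homI) (use assms in \<open>auto simp: add.assoc elim!: u_prodE\<close>)

text \<open>Equality of nested codes is reduced to equality of nested classes, where
  \<open>zassoc_eq_iff\<close> applies.\<close>

lemma u_assoc_iso:
  assumes "centrally_graded M1" "centrally_graded M2" "centrally_graded M3"
  shows "cg_iso (u_prod p (u_prod p M1 M2) M3) (u_prod p M1 (u_prod p M2 M3)) (u_assoc p M1 M2 M3)"
proof (rule cg_isoI)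
  \<comment> \<open>Coding the inner class changes nothing: the criterion for the outer class leaves
    an equality of inner codes, and these agree iff the inner classes do.\<close>
  have right: "u_pair p M1 (u_prod p M2 M3) a (u_pair p M2 M3 b c) =
      u_pair p M1 (u_prod p M2 M3) a' (u_pair p M2 M3 b' c') \<longleftrightarrow>
      zclass M1 (M2 \<times>\<^sub>z M3) a (zclass M2 M3 b c) = zclass M1 (M2 \<times>\<^sub>z M3) a' (zclass M2 M3 b' c')"
    if "a \<in> carrier M1" "b \<in> carrier M2" "c \<in> carrier M3"
      "a' \<in> carrier M1" "b' \<in> carrier M2" "c' \<in> carrier M3" for a b c a' b' c'
    using that assms by (simp add: zclass_eq_iff u_pair_eq_iff)
  have "u_pair p (u_prod p M1 M2) M3 (u_pair p M1 M2 a b) c =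
      u_pair p (u_prod p M1 M2) M3 (u_pair p M1 M2 a' b') c' \<longleftrightarrow>
      zclass (M1 \<times>\<^sub>z M2) M3 (zclass M1 M2 a b) c = zclass (M1 \<times>\<^sub>z M2) M3 (zclass M1 M2 a' b') c'"
    if "a \<in> carrier M1" "b \<in> carrier M2" "c \<in> carrier M3"
      "a' \<in> carrier M1" "b' \<in> carrier M2" "c' \<in> carrier M3" for a b c a' b' c'
    using that assms by (simp add: zclass_eq_iff u_pair_eq_iff)
  with right show "inj_on (u_assoc p M1 M2 M3) (carrier (u_prod p (u_prod p M1 M2) M3))"
    using assms by (intro inj_onI; elim u_prodE) (simp add: zassoc_eq_iff)
  show "\<exists>u\<in>carrier (u_prod p (u_prod p M1 M2) M3). u_assoc p M1 M2 M3 u = v"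
    if "v \<in> carrier (u_prod p M1 (u_prod p M2 M3))" for v
    using that assms by (metis u_assoc_u_pair u_pair_closed u_prodE)
qed (use assms in simp_all)

section \<open>Unit isomorphisms on coded classes\<close>

context
  fixes e :: "'g::ab_group_add \<Rightarrow> 'u"
  assumes inj_e: "inj e"
begin

lemma u_lunit_extensional [simp]: "u_lunit p e M \<in> extensional (carrier (u_prod p (u_unit e) M))"
  by (simp add: u_lunit_def)

lemma u_runit_extensional [simp]: "u_runit p e M \<in> extensional (carrier (u_prod p M (u_unit e)))"
  by (simp add: u_runit_def)

lemma u_lunit_u_pair [simp]:
  "\<lbrakk>centrally_graded M; m \<in> carrier M\<rbrakk> \<Longrightarrow>
     u_lunit p e M (u_pair p (u_unit e) M (e x) m) = act M x m"
  by (simp add: u_lunit_def inj_e)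

lemma u_runit_u_pair [simp]:
  "\<lbrakk>centrally_graded M; m \<in> carrier M\<rbrakk> \<Longrightarrow>
     u_runit p e M (u_pair p M (u_unit e) m (e x)) = act M x m"
  by (simp add: u_runit_def inj_e)

lemma u_lunit_hom [simp]:
  "centrally_graded M \<Longrightarrow> u_lunit p e M \<in> cg_hom (u_prod p (u_unit e) M) M"
  by (rule cg_homI) (auto simp: inj_e add.commute elim!: u_prodE)

lemma u_runit_hom [simp]:
  "centrally_graded M \<Longrightarrow> u_runit p e M \<in> cg_hom (u_prod p M (u_unit e)) M"
  by (rule cg_homI) (auto simp: inj_e elim!: u_prodE)

lemma u_lunit_iso:
  assumes "centrally_graded M"
  shows "cg_iso (u_prod p (u_unit e) M) M (u_lunit p e M)"
proof (rule cg_isoI)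
  show "inj_on (u_lunit p e M) (carrier (u_prod p (u_unit e) M))"
  proof (rule inj_onI, elim u_prodE)
    fix u v i m j n
    assume *: "m \<in> carrier M" "n \<in> carrier M" "i \<in> carrier (u_unit e)" "j \<in> carrier (u_unit e)"
        "u = u_pair p (u_unit e) M i m" "v = u_pair p (u_unit e) M j n"
      and eq: "u_lunit p e M u = u_lunit p e M v"
    \<comment> \<open>The unit has carrier \<open>range e\<close>, so its elements are decoded
      first; the rest follows \<open>zlunit_iso\<close>.\<close>
    from * obtain x y where "i = e x" "j = e y" by auto
    moreover from this have "n = act M (x - y) m"
      using * eq assms by (auto intro!: act_eq_actD)
    ultimately show "u = v"
      using * assms by (auto simp: u_pair_eq_iff zclass_eq_iff inj_e intro!: exI [of _ "x - y"])
  qed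
  show "\<exists>u\<in>carrier (u_prod p (u_unit e) M). u_lunit p e M u = m" if "m \<in> carrier M" for m
    using that assms by (intro bexI [of _ "u_pair p (u_unit e) M (e 0) m"]) simp_all
qed (use assms inj_e in simp_all)

lemma u_runit_iso:
  assumes "centrally_graded M"
  shows "cg_iso (u_prod p M (u_unit e)) M (u_runit p e M)"
proof (rule cg_isoI)
  show "inj_on (u_runit p e M) (carrier (u_prod p M (u_unit e)))"
  proof (rule inj_onI, elim u_prodE)
    fix u v m i n j
    assume *: "m \<in> carrier M" "n \<in> carrier M" "i \<in> carrier (u_unit e)" "j \<in> carrier (u_unit e)"
        "u = u_pair p M (u_unit e) m i" "v = u_pair p M (u_unit e) n j"
      and eq: "u_runit p e M u = u_runit p e M v"
    from * obtain x y where "i = e x" "j = e y" by auto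
    moreover from this have "m = act M (y - x) n"
      using * eq assms by (intro act_eq_actD) simp_all
    ultimately show "u = v"
      using * assms by (auto simp: u_pair_eq_iff zclass_eq_iff inj_e intro!: exI [of _ "y - x"])
  qed
  show "\<exists>u\<in>carrier (u_prod p M (u_unit e)). u_runit p e M u = m" if "m \<in> carrier M" for m
    using that assms by (intro bexI [of _ "u_pair p M (u_unit e) m (e 0)"]) simp_all
qed (use assms inj_e in simp_all)

section \<open>The monoidal category\<close>

lemma category_cgset:
  "category {M :: ('g, 'u) cgset. centrally_graded M} cg_hom cg_id
     (\<lambda>A B C g f. compose (carrier A) g f)"
  by unfold_locales (simp_all add: cg_compose_assoc)

lemma monoidal_category_cgset:
  "monoidal_category {M :: ('g, 'u) cgset. centrally_graded M} cg_hom cg_id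
     (\<lambda>A B C g f. compose (carrier A) g f)
     (u_prod p) (u_map p) (u_unit e) (u_assoc p) (u_lunit p e) (u_runit p e)"
proof -
  \<comment> \<open>This makes \<open>iso_in\<close> available and leaves only the monoidal axioms
    to be shown.\<close>
  interpret category "{M :: ('g, 'u) cgset. centrally_graded M}" cg_hom cg_id
    "\<lambda>A B C g f. compose (carrier A) g f"
    by (rule category_cgset)
  \<comment> \<open>Composition depends on its object parameters only through the domain, so both
    notions unfold to the same formula.\<close>
  have iso: "iso_in A B f \<longleftrightarrow> cg_iso A B f" for A B f
    by (simp add: iso_in_def cg_iso_def)
  note [simp] = compose_eq inj_e
  show ?thesis
  proof (unfold_locales,
      goal_cases Ten TenM TenM_Id TenM_Comp Unit Assoc Assoc_natural
        LUnit LUnit_natural RUnit RUnit_natural pentagon triangle)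
    case Ten then show ?case by simp
  next
    case TenM then show ?case by simp
  next
    case TenM_Id then show ?case
      by (intro u_prod_fun_eqI [OF u_map_extensional cg_id_extensional]) simp_all
  next
    case TenM_Comp then show ?case
      by (intro u_prod_fun_eqI [OF u_map_extensional compose_extensional]) simp_all
  next
    case Unit then show ?case by (simp add: inj_e)
  next
    case Assoc then show ?case by (simp add: iso u_assoc_iso)
  next
    \<comment> \<open>The extensionality rule splits only the outermost product;
      \<open>u_prodE\<close> splits the remaining factors.\<close>
    case Assoc_natural then show ?case
      by (intro u_prod_fun_eqI [OF compose_extensional compose_extensional]) (auto elim!: u_prodE)
  next
    case LUnit then show ?case by (simp add: iso u_lunit_iso)
  next
    case LUnit_natural then show ?case
      by (intro u_prod_fun_eqI [OF compose_extensional compose_extensional]) auto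
  next
    case RUnit then show ?case by (simp add: iso u_runit_iso)
  next
    case RUnit_natural then show ?case
      by (intro u_prod_fun_eqI [OF compose_extensional compose_extensional]) auto
  next
    case pentagon then show ?case
      by (intro u_prod_fun_eqI [OF compose_extensional compose_extensional]) (auto elim!: u_prodE)
  next
    case triangle then show ?case
      by (intro u_prod_fun_eqI [OF compose_extensional u_map_extensional]) (auto elim!: u_prodE)
  qed
qed

end

end

text \<open>The laws are stated for carriers of unrelated types, where the products live in ever
  larger types, and then as a locale instance inside one type \<open>'u\<close>. By
  \<open>universe_exists\<close> suitable injections \<open>p\<close> and \<open>e\<close> exist for
  some \<open>'u\<close>, so the last conjunct is not vacuous.\<close>

theorem theorem0p4:
  fixes M1 :: "('g::ab_group_add, 'a1) cgset" and M2 :: "('g, 'a2) cgset"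
    and M3 :: "('g, 'a3) cgset" and M4 :: "('g, 'a4) cgset"
    and N1 :: "('g, 'b1) cgset" and N2 :: "('g, 'b2) cgset" and N3 :: "('g, 'b3) cgset"
    and P1 :: "('g, 'c1) cgset" and P2 :: "('g, 'c2) cgset"
    and p :: "'u \<times> 'u \<Rightarrow> 'u" and e :: "'g \<Rightarrow> 'u"
  assumes "centrally_graded M1" "centrally_graded M2" "centrally_graded M3" "centrally_graded M4"
    and "centrally_graded N1" "centrally_graded N2" "centrally_graded N3"
    and "centrally_graded P1" "centrally_graded P2"
  shows
    \<comment> \<open>the product is well defined and centrally graded\<close>
    "equiv (carrier M1 \<times> carrier M2) (zrel M1 M2) \<and>
     (\<lambda>(m1, m2). deg M1 m1 + deg M2 m2) respects zrel M1 M2 \<and>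
     (\<forall>x. (\<lambda>(m1, m2). zclass M1 M2 (act M1 x m1) m2) respects zrel M1 M2) \<and>
     (\<forall>m1\<in>carrier M1. \<forall>m2\<in>carrier M2.
        deg (M1 \<times>\<^sub>z M2) (zclass M1 M2 m1 m2) = deg M1 m1 + deg M2 m2 \<and>
        (\<forall>x. act (M1 \<times>\<^sub>z M2) x (zclass M1 M2 m1 m2) = zclass M1 M2 (act M1 x m1) m2 \<and>
             zclass M1 M2 (act M1 x m1) m2 = zclass M1 M2 m1 (act M2 x m2))) \<and>
     centrally_graded (M1 \<times>\<^sub>z M2) \<and>
     \<comment> \<open>identities and composition\<close>
     cg_id M1 \<in> cg_hom M1 M1 \<and>
     (\<forall>f\<in>cg_hom M1 N1. compose (carrier M1) f (cg_id M1) = f \<and> compose (carrier M1) (cg_id N1) f = f \<and>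
        (\<forall>g\<in>cg_hom N1 P1. compose (carrier M1) g f \<in> cg_hom M1 P1 \<and>
           (\<forall>h\<in>cg_hom P1 P2. compose (carrier M1) h (compose (carrier M1) g f) =
              compose (carrier M1) (compose (carrier N1) h g) f))) \<and>
     \<comment> \<open>the product is a bifunctor\<close>
     (\<forall>f1\<in>cg_hom M1 N1. \<forall>f2\<in>cg_hom M2 N2.
        zmap M1 M2 N1 N2 f1 f2 \<in> cg_hom (M1 \<times>\<^sub>z M2) (N1 \<times>\<^sub>z N2) \<and>
        (\<forall>m1\<in>carrier M1. \<forall>m2\<in>carrier M2.
           zmap M1 M2 N1 N2 f1 f2 (zclass M1 M2 m1 m2) = zclass N1 N2 (f1 m1) (f2 m2))) \<and>
     zmap M1 M2 M1 M2 (cg_id M1) (cg_id M2) = cg_id (M1 \<times>\<^sub>z M2) \<and>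
     (\<forall>f1\<in>cg_hom M1 N1. \<forall>f2\<in>cg_hom M2 N2. \<forall>g1\<in>cg_hom N1 P1. \<forall>g2\<in>cg_hom N2 P2.
        zmap M1 M2 P1 P2 (compose (carrier M1) g1 f1) (compose (carrier M2) g2 f2) =
        compose (carrier (M1 \<times>\<^sub>z M2)) (zmap N1 N2 P1 P2 g1 g2) (zmap M1 M2 N1 N2 f1 f2)) \<and>
     \<comment> \<open>associativity\<close>
     (\<forall>m1\<in>carrier M1. \<forall>m2\<in>carrier M2. \<forall>m3\<in>carrier M3.
        zassoc M1 M2 M3 (zclass (M1 \<times>\<^sub>z M2) M3 (zclass M1 M2 m1 m2) m3) =
        zclass M1 (M2 \<times>\<^sub>z M3) m1 (zclass M2 M3 m2 m3)) \<and>
     cg_iso ((M1 \<times>\<^sub>z M2) \<times>\<^sub>z M3) (M1 \<times>\<^sub>z (M2 \<times>\<^sub>z M3)) (zassoc M1 M2 M3) \<and>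
     (\<forall>f1\<in>cg_hom M1 N1. \<forall>f2\<in>cg_hom M2 N2. \<forall>f3\<in>cg_hom M3 N3.
        compose (carrier ((M1 \<times>\<^sub>z M2) \<times>\<^sub>z M3)) (zassoc N1 N2 N3)
          (zmap (M1 \<times>\<^sub>z M2) M3 (N1 \<times>\<^sub>z N2) N3 (zmap M1 M2 N1 N2 f1 f2) f3) =
        compose (carrier ((M1 \<times>\<^sub>z M2) \<times>\<^sub>z M3))
          (zmap M1 (M2 \<times>\<^sub>z M3) N1 (N2 \<times>\<^sub>z N3) f1 (zmap M2 M3 N2 N3 f2 f3)) (zassoc M1 M2 M3)) \<and>
     \<comment> \<open>the unit\<close>
     centrally_graded (zunit :: ('g, 'g) cgset) \<and>
     (\<forall>x. \<forall>m\<in>carrier M1. zlunit M1 (zclass zunit M1 x m) = act M1 x m) \<and>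
     (\<forall>x. \<forall>m\<in>carrier M1. zrunit M1 (zclass M1 zunit m x) = act M1 x m) \<and>
     cg_iso (zunit \<times>\<^sub>z M1) M1 (zlunit M1) \<and>
     cg_iso (M1 \<times>\<^sub>z zunit) M1 (zrunit M1) \<and>
     (\<forall>f\<in>cg_hom M1 N1.
        compose (carrier (zunit \<times>\<^sub>z M1)) (zlunit N1) (zmap zunit M1 zunit N1 (cg_id zunit) f) =
        compose (carrier (zunit \<times>\<^sub>z M1)) f (zlunit M1) \<and>
        compose (carrier (M1 \<times>\<^sub>z zunit)) (zrunit N1) (zmap M1 zunit N1 zunit f (cg_id zunit)) =
        compose (carrier (M1 \<times>\<^sub>z zunit)) f (zrunit M1)) \<and>
     \<comment> \<open>pentagon and triangle\<close>
     compose (carrier (((M1 \<times>\<^sub>z M2) \<times>\<^sub>z M3) \<times>\<^sub>z M4))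
       (zassoc M1 M2 (M3 \<times>\<^sub>z M4)) (zassoc (M1 \<times>\<^sub>z M2) M3 M4) =
     compose (carrier (((M1 \<times>\<^sub>z M2) \<times>\<^sub>z M3) \<times>\<^sub>z M4))
       (zmap M1 ((M2 \<times>\<^sub>z M3) \<times>\<^sub>z M4) M1 (M2 \<times>\<^sub>z (M3 \<times>\<^sub>z M4)) (cg_id M1) (zassoc M2 M3 M4))
       (compose (carrier (((M1 \<times>\<^sub>z M2) \<times>\<^sub>z M3) \<times>\<^sub>z M4))
         (zassoc M1 (M2 \<times>\<^sub>z M3) M4)
         (zmap ((M1 \<times>\<^sub>z M2) \<times>\<^sub>z M3) M4 (M1 \<times>\<^sub>z (M2 \<times>\<^sub>z M3)) M4 (zassoc M1 M2 M3) (cg_id M4))) \<and>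
     compose (carrier ((M1 \<times>\<^sub>z zunit) \<times>\<^sub>z M2))
       (zmap M1 (zunit \<times>\<^sub>z M2) M1 M2 (cg_id M1) (zlunit M2)) (zassoc M1 zunit M2) =
     zmap (M1 \<times>\<^sub>z zunit) M2 M1 M2 (zrunit M1) (cg_id M2) \<and>
     \<comment> \<open>the monoidal category of centrally graded sets with carrier in the type 'u\<close>
     (inj p \<longrightarrow> inj e \<longrightarrow>
       monoidal_category {M :: ('g, 'u) cgset. centrally_graded M} cg_hom cg_id
         (\<lambda>A B C g f. compose (carrier A) g f)
         (u_prod p) (u_map p) (u_unit e) (u_assoc p) (u_lunit p e) (u_runit p e))"
  using assms
  by (intro conjI ballI allI impI)
    (simp_all add: cg_compose_assoc zmap_id zmap_compose zassoc_iso zassoc_natural zlunit_iso zrunit_iso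
      zlunit_natural zrunit_natural pentagon_zassoc triangle_zunit monoidal_category_cgset
      deg_respects_zrel act_respects_zrel)

end
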